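(* Let $n\geq0$ and $\alpha=(\alpha_1,\dots,\alpha_n)\in\{0,1\}^n$, and let $k$ be the number of $i$ with $\alpha_i=1$. Then $$v_\alpha=\sum_{X\in B_q(n)}(-1)^{|S(\alpha)\cap P(X)|}\,q^{d(\alpha,X)}\,X.$$ In particular $v_\alpha(\{0\})=q^{k(n-k)}$ and $v_\alpha(\mathbb{F}_q^n)=(-1)^k$.
   Context: $q$ is a prime power. For $m\geq0$, $\mathbb{F}_q^m$ is the space of column vectors of length $m$ over $\mathbb{F}_q$; for $j<m$, $\mathbb{F}_q^j$ is identified with the subspace of $\mathbb{F}_q^m$ of vectors whose last $m-j$ coordinates vanish. $B_q(m)$ is the set of subspaces of $\mathbb{F}_q^m$; $\mathbb{C}[B_q(m)]$ is the complex vector space with basis $B_q(m)$, and $\mathbb{C}[B_q(m)]\subseteq\mathbb{C}[B_q(m+1)]$; for $v=\sum_Xv(X)X$, $v(X)$ are the coordinates. $A_q(m+1)=\{Y\in B_q(m+1):Y\not\subseteq\mathbb{F}_q^m\}$, and $\theta_m:\mathbb{C}[B_q(m)]\to\mathbb{C}[B_q(m+1)]$ is linear with $\theta_m(Z)=\sum Y$ over $Y\in A_q(m+1)$ with $Y\cap\mathbb{F}_q^m=Z$. For sequences in $\{0,1\}$ define $v_{()}=\{0\}\in\mathbb{C}[B_q(0)]$, and for $m\geq0$, $\beta\in\{0,1\}^m$ with $k'$ entries equal to $1$: $v_{(\beta,0)}=q^{k'}v_\beta+\theta_m(v_\beta)$ and $v_{(\beta,1)}=q^{m-k'}v_\beta-\theta_m(v_\beta)$,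 where $(\beta,a)$ is $\beta$ with $a$ appended. For $X\in B_q(n)$, $P(X)=\{j\in\{1,\dots,n\}: X\cap\mathbb{F}_q^j\not\subseteq\mathbb{F}_q^{j-1}\}$ (the pivotal indices of the matrix in column reduced echelon form whose column space is $X$). $S(\alpha)=\{i:\alpha_i=1\}$; $d(\alpha,i)=|\{j<i:\alpha_j\neq\alpha_i\}|$; $d(\alpha,X)=\sum_{i\in\{1,\dots,n\}\setminus P(X)}d(\alpha,i)$. *)

theory Defs
  imports
    Complex_Main
    "HOL-Library.Function_Algebras"
    "HOL-Library.Poly_Mapping"
    "HOL-Library.Cardinality"
    "HOL-Library.Z2"
begin

section \<open>Subspaces of column spaces over a finite field\<close>

text \<open>
  The field with \<open>q\<close> elements is a type \<open>'a\<close> of sort \<open>{field, finite}\<close>, with \<open>q = CARD('a)\<close>.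
  A column vector of length \<open>m\<close> is a function \<open>nat \<Rightarrow> 'a\<close> that vanishes outside \<open>{1..m}\<close>, so that
  for \<open>j < m\<close> the identification of the column space of dimension \<open>j\<close> with the vectors whose last
  \<open>m - j\<close> coordinates vanish is an actual inclusion of sets.
\<close>

definition vscale :: "'a::field \<Rightarrow> (nat \<Rightarrow> 'a) \<Rightarrow> (nat \<Rightarrow> 'a)" where
  "vscale c x = (\<lambda>i. c * x i)"

global_interpretation fvec: vector_space "vscale :: 'a::field \<Rightarrow> _"
  by unfold_locales (auto simp: vscale_def fun_eq_iff algebra_simps)

definition Fq :: "nat \<Rightarrow> (nat \<Rightarrow> 'a::field) set" where
  "Fq m = {x. \<forall>i. i \<notin> {1..m} \<longrightarrow> x i = 0}"

definition Bq :: "nat \<Rightarrow> (nat \<Rightarrow> 'a::field) set set" where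
  "Bq m = {X. fvec.subspace X \<and> X \<subseteq> Fq m}"

text \<open>The set \<open>A\<^sub>q(m)\<close>, for \<open>m \<ge> 1\<close>.\<close>

definition Aq :: "nat \<Rightarrow> (nat \<Rightarrow> 'a::field) set set" where
  "Aq m = {Y \<in> Bq m. \<not> Y \<subseteq> Fq (m - 1)}"

lemma finite_Fq: "finite (Fq m :: (nat \<Rightarrow> 'a::{field, finite}) set)"
proof -
  have "Fq m = {x :: nat \<Rightarrow> 'a. \<forall>i. (i \<in> {1..m} \<longrightarrow> x i \<in> UNIV) \<and> (i \<notin> {1..m} \<longrightarrow> x i = 0)}"
    by (auto simp: Fq_def)
  also have "finite \<dots>" by (rule finite_set_of_finite_funs) auto
  finally show ?thesis .
qed

lemma finite_Bq: "finite (Bq m :: (nat \<Rightarrow> 'a::{field, finite}) set set)"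
  by (rule finite_subset[of _ "Pow (Fq m)"]) (auto simp: Bq_def finite_Fq)


section \<open>Formal linear combinations\<close>

text \<open>
  Formal complex linear combinations of subspaces are finitely supported functions.  The space
  \<open>\<complex>[B\<^sub>q(m)]\<close> consists of those with \<open>keys v \<subseteq> Bq m\<close>; since \<open>Bq m \<subseteq> Bq (m + 1)\<close>,
  it is contained in \<open>\<complex>[B\<^sub>q(m + 1)]\<close>.  The coordinate \<open>v(X)\<close> is \<open>lookup v X\<close>.
\<close>

definition cscale :: "complex \<Rightarrow> ('b \<Rightarrow>\<^sub>0 complex) \<Rightarrow> ('b \<Rightarrow>\<^sub>0 complex)" where
  "cscale c v = Poly_Mapping.map ((*) c) v"

lemma lookup_cscale [simp]: "Poly_Mapping.lookup (cscale c v) X = c * Poly_Mapping.lookup v X"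
  by (simp add: cscale_def Poly_Mapping.map.rep_eq when_def)

global_interpretation cfree: vector_space cscale
  by unfold_locales (auto intro!: poly_mapping_eqI simp: lookup_add algebra_simps)

abbreviation basis :: "'b \<Rightarrow> ('b \<Rightarrow>\<^sub>0 complex)" where
  "basis X \<equiv> Poly_Mapping.single X 1"

text \<open>\<open>theta m\<close> is the linear map on \<open>\<complex>[B\<^sub>q(m)]\<close> determined by its values on the basis.\<close>

definition theta ::
  "nat \<Rightarrow> ((nat \<Rightarrow> 'a::{field, finite}) set \<Rightarrow>\<^sub>0 complex) \<Rightarrow> ((nat \<Rightarrow> 'a) set \<Rightarrow>\<^sub>0 complex)" where
  "theta m v = (\<Sum>Z\<in>Bq m. cscale (Poly_Mapping.lookup v Z)
                   (\<Sum>Y\<in>{Y \<in> Aq (m + 1). Y \<inter> Fq m = Z}. basis Y))"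

lemma theta_linear: "Vector_Spaces.linear cscale cscale (theta m)"
  unfolding Vector_Spaces.linear_iff
  by (auto simp: theta_def lookup_add cfree.scale_left_distrib sum.distrib cfree.scale_sum_right
                 cfree.vector_space_axioms)

lemma theta_basis:
  assumes "Z \<in> Bq m"
  shows "theta m (basis Z) = (\<Sum>Y\<in>{Y \<in> Aq (m + 1). Y \<inter> Fq m = Z}. basis Y)"
proof -
  have "theta m (basis Z) =
      (\<Sum>W\<in>Bq m. if W = Z then (\<Sum>Y\<in>{Y \<in> Aq (m + 1). Y \<inter> Fq m = Z}. basis Y) else 0)"
    unfolding theta_def by (rule sum.cong) (auto simp: lookup_single when_def)
  then show ?thesis using assms by (simp add: finite_Bq)
qed


section \<open>Binary sequences\<close>

text \<open>
  Sequences with entries in \<open>{0, 1}\<close> are lists of type \<open>bit list\<close>; the field structure of \<open>bit\<close> is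
  not used.  Sequences are indexed from 1.
\<close>

definition entry :: "bit list \<Rightarrow> nat \<Rightarrow> bit" where
  "entry \<alpha> i = \<alpha> ! (i - 1)"

definition ones :: "bit list \<Rightarrow> nat set" where
  "ones \<alpha> = {i \<in> {1..length \<alpha>}. entry \<alpha> i = 1}"

definition dseq :: "bit list \<Rightarrow> nat \<Rightarrow> nat" where
  "dseq \<alpha> i = card {j \<in> {1..<i}. entry \<alpha> j \<noteq> entry \<alpha> i}"

definition pivots :: "nat \<Rightarrow> (nat \<Rightarrow> 'a::field) set \<Rightarrow> nat set" where
  "pivots n X = {j \<in> {1..n}. \<not> X \<inter> Fq j \<subseteq> Fq (j - 1)}"

definition dsub :: "bit list \<Rightarrow> (nat \<Rightarrow> 'a::field) set \<Rightarrow> nat" where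
  "dsub \<alpha> X = (\<Sum>i\<in>{1..length \<alpha>} - pivots (length \<alpha>) X. dseq \<alpha> i)"

function vvec :: "bit list \<Rightarrow> ((nat \<Rightarrow> 'a::{field, finite}) set \<Rightarrow>\<^sub>0 complex)" where
  "vvec [] = basis {0}"
| "vvec (\<beta> @ [0]) = cscale (of_nat CARD('a) ^ card (ones \<beta>)) (vvec \<beta>) + theta (length \<beta>) (vvec \<beta>)"
| "vvec (\<beta> @ [1]) = cscale (of_nat CARD('a) ^ (length \<beta> - card (ones \<beta>))) (vvec \<beta>) - theta (length \<beta>) (vvec \<beta>)"
  by (metis bit.exhaust rev_exhaust) auto
termination
  by (relation "measure length") auto

end

theory Submission
  imports Defs
begin

text \<open>
  Induction on the length of \<open>\<alpha>\<close>.  Passing from \<open>\<beta>\<close> of length \<open>m\<close> to \<open>(\<beta>, a)\<close>, a subspace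
  contained in \<open>\<bbbF>\<^sub>q\<^sup>m\<close> does not get the new index \<open>m + 1\<close> as a pivot and only receives the
  contribution of \<open>v\<^sub>\<beta>\<close>, multiplied by \<open>q\<close> to the power \<open>d((\<beta>, a), m + 1)\<close>; a subspace \<open>X\<close> not
  contained in it has the pivot \<open>m + 1\<close> and only receives, up to the sign \<open>(-1)\<^sup>a\<close>, the coordinate of
  \<open>v\<^sub>\<beta>\<close> at \<open>X \<inter> \<bbbF>\<^sub>q\<^sup>m\<close>.
\<close>

lemma Fq_mono: "i \<le> j \<Longrightarrow> Fq i \<subseteq> Fq j"
  by (auto simp: Fq_def)

lemma subspace_Fq: "fvec.subspace (Fq m :: (nat \<Rightarrow> 'a::field) set)"
  by (auto simp: fvec.subspace_def Fq_def vscale_def)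

lemma Int_Fq_in_Bq: "X \<in> Bq n \<Longrightarrow> X \<inter> Fq m \<in> Bq m"
  by (auto simp: Bq_def intro: fvec.subspace_inter subspace_Fq)

lemma Bq_Suc_iff: "X \<subseteq> Fq m \<Longrightarrow> X \<in> Bq (Suc m) \<longleftrightarrow> X \<in> Bq m"
  using Fq_mono[of m "Suc m"] by (auto simp: Bq_def)

text \<open>A given \<open>Y\<close> is produced by exactly one basis element, its trace
  \<open>Y \<inter> Fq m\<close>, so the double sum collapses to one term. This holds for every
  \<open>v\<close>, with no condition on its support.\<close>

lemma lookup_theta:
  "Poly_Mapping.lookup (theta m v) X =
    (if X \<in> Aq (Suc m) then Poly_Mapping.lookup v (X \<inter> Fq m) else 0)"
proof -
  have fin: "finite (Aq (Suc m) :: (nat \<Rightarrow> 'a) set set)"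
    by (rule finite_subset[OF _ finite_Bq[of "Suc m"]]) (auto simp: Aq_def)
  have "Poly_Mapping.lookup (theta m v) X = (\<Sum>Z\<in>Bq m. Poly_Mapping.lookup v Z *
      (\<Sum>Y\<in>{Y \<in> Aq (Suc m). Y \<inter> Fq m = Z}. if Y = X then 1 else 0))"
    by (simp add: theta_def lookup_sum lookup_single when_def)
  also have "\<dots> = (\<Sum>Z\<in>Bq m. if X \<inter> Fq m = Z then
      (if X \<in> Aq (Suc m) then Poly_Mapping.lookup v Z else 0) else 0)"
    using fin by (intro sum.cong) auto
  also have "\<dots> = (if X \<in> Aq (Suc m) then Poly_Mapping.lookup v (X \<inter> Fq m) else 0)"
    \<comment> \<open>The surviving index \<open>X \<inter> Fq m\<close> does occur in the sum over
      \<open>Bq m\<close>, because it is again a subspace.\<close>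
    by (auto simp: finite_Bq Aq_def intro: Int_Fq_in_Bq)
  finally show ?thesis .
qed

lemma entry_snoc: "entry (\<beta> @ [a]) j = (if j - 1 < length \<beta> then entry \<beta> j else [a] ! (j - 1 - length \<beta>))"
  by (simp add: entry_def nth_append)

lemma ones_subset: "ones \<beta> \<subseteq> {1..length \<beta>}"
  by (auto simp: ones_def)

lemma finite_ones: "finite (ones \<beta>)"
  by (rule finite_subset[OF ones_subset]) simp

lemma card_ones_le: "card (ones \<beta>) \<le> length \<beta>"
  using card_mono[OF _ ones_subset] by simp

lemma ones_snoc:
  "ones (\<beta> @ [a]) = (if a = 1 then insert (Suc (length \<beta>)) (ones \<beta>) else ones \<beta>)"
  by (auto simp: ones_def entry_snoc split: if_splits)

lemma dseq_snoc: "i \<in> {1..length \<beta>} \<Longrightarrow> dseq (\<beta> @ [a]) i = dseq \<beta> i"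
  unfolding dseq_def by (intro arg_cong[of _ _ card]) (auto simp: entry_snoc)

text \<open>The entries that differ from an appended 1 are the zeros of \<open>\<beta>\<close>, and
  those that differ from an appended 0 are its ones. These counts are the exponents in the recursion
  for \<open>vvec\<close>, so its two clauses become one formula up to sign.\<close>

lemma dseq_snoc_last:
  "dseq (\<beta> @ [a]) (Suc (length \<beta>)) =
    (if a = 1 then length \<beta> - card (ones \<beta>) else card (ones \<beta>))"
proof -
  have "{j \<in> {1..<Suc (length \<beta>)}. entry (\<beta> @ [a]) j \<noteq> entry (\<beta> @ [a]) (Suc (length \<beta>))} =
      (if a = 1 then {1..length \<beta>} - ones \<beta> else ones \<beta>)"
    by (auto simp: ones_def entry_snoc)
  moreover have "card ({1..length \<beta>} - ones \<beta>) = length \<beta> - card (ones \<beta>)"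
    using card_Diff_subset[OF finite_ones ones_subset] by simp
  ultimately show ?thesis
    by (simp only: dseq_def if_distrib[of card])
qed

lemma lookup_vvec_snoc:
  "Poly_Mapping.lookup (vvec (\<beta> @ [a]) :: (nat \<Rightarrow> 'a::{field, finite}) set \<Rightarrow>\<^sub>0 complex) X =
    of_nat CARD('a) ^ dseq (\<beta> @ [a]) (Suc (length \<beta>)) * Poly_Mapping.lookup (vvec \<beta>) X +
    (if a = 1 then -1 else 1) * Poly_Mapping.lookup (theta (length \<beta>) (vvec \<beta>)) X"
  by (cases a) (simp_all only: vvec.simps dseq_snoc_last, simp_all add: lookup_add lookup_minus)

lemma pivots_subset: "pivots n X \<subseteq> {1..n}"
  by (auto simp: pivots_def)

lemma pivots_Suc_subset: "X \<subseteq> Fq m \<Longrightarrow> pivots (Suc m) X = pivots m X"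
  by (auto simp: pivots_def le_Suc_eq)

text \<open>For \<open>j \<le> m\<close> the pivot condition only sees
  \<open>X \<inter> Fq j\<close>, which cutting \<open>X\<close> down to \<open>Fq m\<close> leaves
  unchanged.\<close>

lemma pivots_Suc_not_subset:
  assumes "X \<subseteq> Fq (Suc m)" "\<not> X \<subseteq> Fq m"
  shows "pivots (Suc m) X = insert (Suc m) (pivots m (X \<inter> Fq m))"
proof -
  have "X \<inter> Fq m \<inter> Fq j = X \<inter> Fq j" if "j \<le> m" for j
    using Fq_mono[OF that] by blast
  then show ?thesis
    using assms by (auto simp: pivots_def le_Suc_eq)
qed

lemma dsub_snoc_subset:
  assumes "X \<subseteq> Fq (length \<beta>)"
  shows "dsub (\<beta> @ [a]) X = dsub \<beta> X + dseq (\<beta> @ [a]) (Suc (length \<beta>))"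
proof -
  have "{1..Suc (length \<beta>)} - pivots (length \<beta>) X =
      insert (Suc (length \<beta>)) ({1..length \<beta>} - pivots (length \<beta>) X)"
    using pivots_subset[of "length \<beta>" X] by auto
  then show ?thesis
    by (simp add: dsub_def pivots_Suc_subset[OF assms] dseq_snoc)
qed

lemma dsub_snoc_not_subset:
  assumes "X \<subseteq> Fq (Suc (length \<beta>))" "\<not> X \<subseteq> Fq (length \<beta>)"
  shows "dsub (\<beta> @ [a]) X = dsub \<beta> (X \<inter> Fq (length \<beta>))"
proof -
  let ?P = "pivots (length \<beta>) (X \<inter> Fq (length \<beta>))"
  have "{1..Suc (length \<beta>)} - insert (Suc (length \<beta>)) ?P = {1..length \<beta>} - ?P"
    by auto
  then show ?thesis
    by (simp add: dsub_def pivots_Suc_not_subset[OF assms] dseq_snoc)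
qed

text \<open>Including the value 0 off \<open>Bq\<close> carries the support of \<open>vvec\<close>
  through the induction. \<open>X\<close> stays arbitrary because the hypothesis is also applied to
  \<open>X \<inter> Fq ?m\<close>.\<close>

lemma lookup_vvec:
  "Poly_Mapping.lookup (vvec \<alpha>) (X :: (nat \<Rightarrow> 'a::{field, finite}) set) =
    (if X \<in> Bq (length \<alpha>)
     then (-1) ^ card (ones \<alpha> \<inter> pivots (length \<alpha>) X) * of_nat CARD('a) ^ dsub \<alpha> X else 0)"
proof (induction \<alpha> arbitrary: X rule: rev_induct)
  case Nil
  have "Bq 0 = {{0 :: nat \<Rightarrow> 'a}}"
    by (auto simp: Bq_def Fq_def fvec.subspace_def vscale_def fun_eq_iff)
  then show ?case
    by (auto simp: lookup_single when_def ones_def dsub_def)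
next
  case (snoc a \<beta>)
  let ?m = "length \<beta>"
  consider "X \<notin> Bq (Suc ?m)" | "X \<in> Bq (Suc ?m)" "X \<subseteq> Fq ?m"
    | "X \<in> Bq (Suc ?m)" "\<not> X \<subseteq> Fq ?m" by blast
  then show ?case
  proof cases
    case 1
    then have "X \<notin> Aq (Suc ?m)" "X \<notin> Bq ?m"
      using Bq_Suc_iff[of X ?m] by (auto simp: Aq_def Bq_def)
    with 1 show ?thesis by (simp add: lookup_vvec_snoc lookup_theta snoc.IH)
  next
    case 2
    then have "X \<notin> Aq (Suc ?m)" "X \<in> Bq ?m"
      using Bq_Suc_iff[of X ?m] by (auto simp: Aq_def)
    \<comment> \<open>An appended 1 sits at \<open>Suc ?m\<close>, which is no pivot here, so the
      sign does not change.\<close>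
    moreover have "ones (\<beta> @ [a]) \<inter> pivots ?m X = ones \<beta> \<inter> pivots ?m X"
      using pivots_subset[of ?m X] by (auto simp: ones_snoc)
    ultimately show ?thesis
      using 2 by (simp add: lookup_vvec_snoc lookup_theta snoc.IH pivots_Suc_subset
          dsub_snoc_subset power_add)
  next
    case 3
    let ?Y = "X \<inter> Fq ?m"
    have X: "X \<subseteq> Fq (Suc ?m)" and A: "X \<in> Aq (Suc ?m)" and B: "X \<notin> Bq ?m"
      using 3 by (auto simp: Bq_def Aq_def)
    have "Suc ?m \<notin> pivots ?m ?Y" "Suc ?m \<notin> ones \<beta>"
      using pivots_subset[of ?m ?Y] ones_subset[of \<beta>] by auto
    \<comment> \<open>The new pivot \<open>Suc ?m\<close> is fresh and meets
      \<open>ones (\<beta> @ [a])\<close> exactly when \<open>a = 1\<close>; the extra factor -1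
      then matches the sign in front of \<open>theta\<close>.\<close>
    then have "(-1 :: complex) ^ card (ones (\<beta> @ [a]) \<inter> pivots (Suc ?m) X) =
        (if a = 1 then -1 else 1) * (-1) ^ card (ones \<beta> \<inter> pivots ?m ?Y)"
      by (simp add: pivots_Suc_not_subset[OF X 3(2)] ones_snoc finite_ones)
    then show ?thesis
      using 3 A B Int_Fq_in_Bq[OF 3(1), of ?m]
      by (simp add: lookup_vvec_snoc lookup_theta snoc.IH dsub_snoc_not_subset[OF X 3(2)])
  qed
qed

lemma pivots_zero: "pivots n {0} = {}"
  by (auto simp: pivots_def Fq_def)

lemma pivots_Fq: "pivots n (Fq n :: (nat \<Rightarrow> 'a::field) set) = {1..n}"
proof (rule antisym[OF pivots_subset], rule subsetI)
  fix j assume j: "j \<in> {1..n}"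
  \<comment> \<open>The \<open>j\<close>-th unit vector witnesses that \<open>j\<close> is a
    pivot.\<close>
  let ?e = "\<lambda>i. if i = j then 1 else 0 :: 'a"
  have "?e \<in> Fq n \<inter> Fq j" "?e \<notin> Fq (j - 1)"
    using j by (auto simp: Fq_def)
  with j show "j \<in> pivots n (Fq n :: (nat \<Rightarrow> 'a) set)"
    unfolding pivots_def by blast
qed

text \<open>Without pivots the sum runs over all indices and counts the pairs of positions with
  different entries, that is, pairs of a one and a zero.\<close>

lemma dsub_zero:
  "dsub \<alpha> ({0} :: (nat \<Rightarrow> 'a::field) set) = card (ones \<alpha>) * (length \<alpha> - card (ones \<alpha>))"
proof (induction \<alpha> rule: rev_induct)
  case Nil
  then show ?case by (simp add: dsub_def)
next
  case (snoc a \<beta>)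
  have "{0} \<subseteq> (Fq (length \<beta>) :: (nat \<Rightarrow> 'a) set)" by (auto simp: Fq_def)
  moreover have "Suc (length \<beta>) \<notin> ones \<beta>" using ones_subset[of \<beta>] by auto
  ultimately show ?case
    unfolding dsub_snoc_subset[OF \<open>{0} \<subseteq> _\<close>] snoc.IH
    \<comment> \<open>This bound keeps the truncated subtraction exact when the length grows by
      one.\<close>
    using card_ones_le[of \<beta>]
    by (simp add: dseq_snoc_last ones_snoc finite_ones Suc_diff_le add.commute)
qed

theorem theorem4p6:
  fixes \<alpha> :: "bit list" and n k :: nat and q :: complex
    and v :: "(nat \<Rightarrow> 'a::{field, finite}) set \<Rightarrow>\<^sub>0 complex"
  assumes "length \<alpha> = n"
    and "k = card {i \<in> {1..n}. entry \<alpha> i = 1}"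
    and "q = of_nat CARD('a)"
    and "v = vvec \<alpha>"
  shows "v = (\<Sum>X\<in>Bq n. cscale ((-1) ^ card (ones \<alpha> \<inter> pivots n X) * q ^ dsub \<alpha> X) (basis X))
    \<and> Poly_Mapping.lookup v {0} = q ^ (k * (n - k))
    \<and> Poly_Mapping.lookup v (Fq n) = (-1) ^ k"
proof (intro conjI)
  have n: "n = length \<alpha>" and k: "k = card (ones \<alpha>)"
    using assms(1,2) by (auto simp: ones_def)
  show "v = (\<Sum>X\<in>Bq n. cscale ((-1) ^ card (ones \<alpha> \<inter> pivots n X) * q ^ dsub \<alpha> X) (basis X))"
    unfolding assms(3,4) n
    by (rule poly_mapping_eqI)
      (simp add: lookup_vvec lookup_sum lookup_single when_def finite_Bq if_distrib cong: if_cong)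
  have "({0} :: (nat \<Rightarrow> 'a) set) \<in> Bq n"
    by (auto simp: Bq_def Fq_def fvec.subspace_def vscale_def fun_eq_iff)
  then show "Poly_Mapping.lookup v {0} = q ^ (k * (n - k))"
    by (simp add: assms(3,4) n k lookup_vvec pivots_zero dsub_zero)
  have "(Fq n :: (nat \<Rightarrow> 'a) set) \<in> Bq n"
    by (simp add: Bq_def subspace_Fq)
  moreover have "ones \<alpha> \<inter> {1..n} = ones \<alpha>"
    using ones_subset[of \<alpha>] n by auto
  \<comment> \<open>Every index is a pivot of the full space, so the sum in \<open>dsub\<close> is
    empty and the power of \<open>q\<close> is 1.\<close>
  ultimately show "Poly_Mapping.lookup v (Fq n) = (-1) ^ k"
    by (simp add: assms(3,4) n k lookup_vvec pivots_Fq dsub_def)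
qed

end
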